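(* Let $r,s,t\ge 1$ be integers, and let $\mathbf{a}(z),\mathbf{b}(z)\in\mathbb{C}[z]^{r\times r}$ be matrix polynomials of degrees $s$ and $t$ respectively, with $\det\mathbf{a}(z)\not\equiv0$ and $\det\mathbf{b}(z)\not\equiv 0$. Suppose there are matrices $\mathbf{D_A},\mathbf{A}\in\mathbb{C}^{rs\times rs}$, $\mathbf{X_A}\in\mathbb{C}^{r\times rs}$, $\mathbf{Y_A}\in\mathbb{C}^{rs\times r}$ with $$\det\mathbf{a}(z)=\det(z\mathbf{D_A}-\mathbf{A}),\qquad \mathbf{a}^{-1}(z)=\mathbf{X_A}(z\mathbf{D_A}-\mathbf{A})^{-1}\mathbf{Y_A}\ \text{ for } z\in\mathbb{C}\setminus\Lambda(\mathbf{a}),$$ and matrices $\mathbf{D_B},\mathbf{B}\in\mathbb{C}^{rt\times rt}$, $\mathbf{X_B}\in\mathbb{C}^{r\times rt}$, $\mathbf{Y_B}\in\mathbb{C}^{rt\times r}$ with $$\det\mathbf{b}(z)=\det(z\mathbf{D_B}-\mathbf{B}),\qquad \mathbf{b}^{-1}(z)=\mathbf{X_B}(z\mathbf{D_B}-\mathbf{B})^{-1}\mathbf{Y_B}\ \text{ for } z\in\mathbb{C}\setminus\Lambda(\mathbf{b}).$$ Define $$\mathbf{F}_1=\begin{bmatrix}\mathbf{A}&\mathbf{0}\\\mathbf{Y_B}\mathbf{X_A}&\mathbf{B}\end{bmatrix},\quad \mathbf{D}_{\mathbf{F}_1}=\begin{bmatrix}\mathbf{D_A}&\mathbf{0}\\\mathbf{0}&\mathbf{D_B}\end{bmatrix},\qquad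 \mathbf{F}_2=\begin{bmatrix}\mathbf{B}&\mathbf{Y_B}\mathbf{X_A}\\\mathbf{0}&\mathbf{A}\end{bmatrix},\quad \mathbf{D}_{\mathbf{F}_2}=\begin{bmatrix}\mathbf{D_B}&\mathbf{0}\\\mathbf{0}&\mathbf{D_A}\end{bmatrix}.$$ Then $z\mathbf{D}_{\mathbf{F}_1}-\mathbf{F}_1$ and $z\mathbf{D}_{\mathbf{F}_2}-\mathbf{F}_2$ are linearizations of the product $\mathbf{a}(z)\mathbf{b}(z)$.
   Context: For a matrix polynomial $\mathbf{p}(z)\in\mathbb{C}[z]^{r\times r}$, $\Lambda(\mathbf{p})=\{z\in\mathbb{C}:\det\mathbf{p}(z)=0\}$, and $\mathbf{p}^{-1}(z)=(\mathbf{p}(z))^{-1}$. A pencil $z\mathbf{D}-\mathbf{M}$ with $\mathbf{D},\mathbf{M}\in\mathbb{C}^{N\times N}$ is called a linearization of $\mathbf{p}(z)$ if $\det(z\mathbf{D}-\mathbf{M})=\det\mathbf{p}(z)$ for all $z$ and there are constant matrices $\mathbf{X}\in\mathbb{C}^{r\times N}$, $\mathbf{Y}\in\mathbb{C}^{N\times r}$ with $\mathbf{X}(z\mathbf{D}-\mathbf{M})^{-1}\mathbf{Y}=\mathbf{p}^{-1}(z)$ for all $z\notin\Lambda(\mathbf{p})$. *)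

theory Defs
  imports
    Complex_Main
    "Jordan_Normal_Form.Determinant"
    "Jordan_Normal_Form.Gauss_Jordan_Elimination"
begin

text \<open>A matrix polynomial is a matrix whose entries are polynomials, so products of matrix
  polynomials are the ordinary products of \<^typ>\<open>complex poly mat\<close>.\<close>

definition mpoly_eval :: "complex poly mat \<Rightarrow> complex \<Rightarrow> complex mat" where
  "mpoly_eval P z = map_mat (\<lambda>f. poly f z) P"

text \<open>The largest power of the variable with a nonzero coefficient matrix; only meaningful for
  matrices with at least one entry. As for \<^const>\<open>degree\<close>, the zero matrix has degree 0.\<close>

definition mpoly_degree :: "complex poly mat \<Rightarrow> nat" where
  "mpoly_degree P = Max (degree ` elements_mat P)"

definition mpoly_spectrum :: "complex poly mat \<Rightarrow> complex set" where
  "mpoly_spectrum P = {z. det (mpoly_eval P z) = 0}"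

text \<open>The inverse of a nonsingular square matrix; unspecified on all other matrices.\<close>

definition mat_inv :: "complex mat \<Rightarrow> complex mat" where
  "mat_inv A = the (mat_inverse A)"

definition pencil :: "complex mat \<Rightarrow> complex mat \<Rightarrow> complex \<Rightarrow> complex mat" where
  "pencil D M z = z \<cdot>\<^sub>m D - M"

definition is_linearization ::
  "nat \<Rightarrow> nat \<Rightarrow> complex mat \<Rightarrow> complex mat \<Rightarrow> complex poly mat \<Rightarrow> bool" where
  "is_linearization r N D M P \<longleftrightarrow>
     P \<in> carrier_mat r r \<and> D \<in> carrier_mat N N \<and> M \<in> carrier_mat N N \<and>
     (\<forall>z. det (pencil D M z) = det (mpoly_eval P z)) \<and>
     (\<exists>X \<in> carrier_mat r N. \<exists>Y \<in> carrier_mat N r.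
        \<forall>z. z \<notin> mpoly_spectrum P \<longrightarrow>
          X * mat_inv (pencil D M z) * Y = mat_inv (mpoly_eval P z))"

end

theory Submission
  imports Defs
begin

text \<open>The lower left block of the inverse of the block triangular pencil of \<open>F\<^sub>1\<close> is
  \<open>(z D\<^sub>B - B)\<^sup>-\<^sup>1 Y\<^sub>B X\<^sub>A (z D\<^sub>A - A)\<^sup>-\<^sup>1\<close>. Multiplying it by \<open>X\<^sub>B\<close> from the left and by \<open>Y\<^sub>A\<close> from
  the right gives \<open>b\<^sup>-\<^sup>1(z) a\<^sup>-\<^sup>1(z)\<close>, so \<open>X = [0 X\<^sub>B]\<close> and \<open>Y = [Y\<^sub>A; 0]\<close> realise the resolvent
  identity. For \<open>F\<^sub>2\<close> the same block sits in the upper right corner.\<close>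

section \<open>Inverses of products and of block triangular matrices\<close>

lemma mat_inv_eqI:
  assumes A: "A \<in> carrier_mat n n" and B: "B \<in> carrier_mat n n" and AB: "A * B = 1\<^sub>m n"
  shows "mat_inv A = B"
proof -
  \<comment> \<open>A right inverse of a square matrix over a field is also a left inverse, which
    makes \<open>A\<close> a unit of the matrix ring.\<close>
  have BA: "B * A = 1\<^sub>m n"
    by (rule mat_mult_left_right_inverse[OF A B AB])
  have "A \<in> Units (ring_mat TYPE(complex) n ())"
    using A B AB BA by (auto simp: Units_def ring_mat_def)
  \<comment> \<open>Gauss-Jordan elimination returns \<open>None\<close> only on non-units, so the
    \<open>the\<close> in \<open>mat_inv\<close> is applied to a genuine value here.\<close>
  then obtain C where "mat_inverse A = Some C"
    using mat_inverse(1)[OF A, where b = "()"] by (cases "mat_inverse A") auto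
  with mat_inverse(2)[OF A this] have C: "C * A = 1\<^sub>m n" "C \<in> carrier_mat n n" "mat_inv A = C"
    by (auto simp: mat_inv_def)
  have "C = C * (A * B)"
    using AB C by simp
  also have "\<dots> = (C * A) * B"
    by (rule assoc_mult_mat[symmetric, OF C(2) A B])
  also have "\<dots> = B"
    using C B by simp
  finally show ?thesis
    using C by simp
qed

lemma
  assumes A: "A \<in> carrier_mat n n" and "det A \<noteq> 0"
  shows mat_inv_right: "A * mat_inv A = 1\<^sub>m n"
    and mat_inv_carrier: "mat_inv A \<in> carrier_mat n n"
proof -
  have "A \<in> Units (ring_mat TYPE(complex) n ())"
    by (rule det_non_zero_imp_unit[OF assms])
  then obtain C where "mat_inverse A = Some C"
    using mat_inverse(1)[OF A, where b = "()"] by (cases "mat_inverse A") auto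
  with mat_inverse(2)[OF A this]
  show "A * mat_inv A = 1\<^sub>m n" "mat_inv A \<in> carrier_mat n n"
    by (auto simp: mat_inv_def)
qed

lemma mat_inv_mult:
  assumes A: "A \<in> carrier_mat n n" and B: "B \<in> carrier_mat n n"
    and "det A \<noteq> 0" and "det B \<noteq> 0"
  shows "mat_inv (A * B) = mat_inv B * mat_inv A"
proof (rule mat_inv_eqI)
  note A' = mat_inv_carrier[OF A assms(3)] and B' = mat_inv_carrier[OF B assms(4)]
  show "A * B \<in> carrier_mat n n" "mat_inv B * mat_inv A \<in> carrier_mat n n"
    using A B A' B' by auto
  have "A * B * (mat_inv B * mat_inv A) = A * (B * (mat_inv B * mat_inv A))"
    using A B A' B' by (intro assoc_mult_mat) auto
  also have "B * (mat_inv B * mat_inv A) = B * mat_inv B * mat_inv A"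
    by (rule assoc_mult_mat[symmetric, OF B B' A'])
  also have "\<dots> = mat_inv A"
    using mat_inv_right[OF B assms(4)] A' by simp
  finally show "A * B * (mat_inv B * mat_inv A) = 1\<^sub>m n"
    using mat_inv_right[OF A assms(3)] by simp
qed

text \<open>Forward substitution: an inverse with lower left block G must satisfy
  \<open>- C * mat_inv P + Q * G = 0\<close>, which determines G. The block is taken as
  \<open>- C\<close> because a pencil subtracts its constant matrix; the inverse then carries no
  sign.\<close>

lemma mat_inv_block_lower:
  assumes P: "P \<in> carrier_mat n n" and Q: "Q \<in> carrier_mat m m" and C: "C \<in> carrier_mat m n"
    and "det P \<noteq> 0" and "det Q \<noteq> 0"
  shows "mat_inv (four_block_mat P (0\<^sub>m n m) (- C) Q)
    = four_block_mat (mat_inv P) (0\<^sub>m n m) (mat_inv Q * (C * mat_inv P)) (mat_inv Q)"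
proof (rule mat_inv_eqI)
  note P' = mat_inv_carrier[OF P assms(4)] and Q' = mat_inv_carrier[OF Q assms(5)]
  have CP: "C * mat_inv P \<in> carrier_mat m n"
    using C P' by simp
  \<comment> \<open>Of the four blocks of the product only the lower left one needs an argument: its
    two summands have to cancel.\<close>
  have "Q * (mat_inv Q * (C * mat_inv P)) = Q * mat_inv Q * (C * mat_inv P)"
    by (rule assoc_mult_mat[symmetric, OF Q Q' CP])
  also have "\<dots> = C * mat_inv P"
    by (simp only: mat_inv_right[OF Q assms(5)] left_mult_one_mat[OF CP])
  finally have "- C * mat_inv P + Q * (mat_inv Q * (C * mat_inv P)) = 0\<^sub>m m n"
    using C P' CP by simp
  then show "four_block_mat P (0\<^sub>m n m) (- C) Q
      * four_block_mat (mat_inv P) (0\<^sub>m n m) (mat_inv Q * (C * mat_inv P)) (mat_inv Q)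
      = 1\<^sub>m (n + m)"
    using P Q C P' Q' CP mat_inv_right[OF P assms(4)] mat_inv_right[OF Q assms(5)]
    by (subst mult_four_block_mat[where ?nr1.0 = n and ?nr2.0 = m and ?n1.0 = n and ?n2.0 = m
          and ?nc1.0 = n and ?nc2.0 = m]) auto
qed (use assms mat_inv_carrier[OF P assms(4)] mat_inv_carrier[OF Q assms(5)] in auto)

text \<open>Swapping the two block rows together with the two block columns leads back to the lower
  triangular case, so the same block appears in the opposite corner.\<close>

lemma mat_inv_block_upper:
  assumes P: "P \<in> carrier_mat n n" and Q: "Q \<in> carrier_mat m m" and C: "C \<in> carrier_mat m n"
    and "det P \<noteq> 0" and "det Q \<noteq> 0"
  shows "mat_inv (four_block_mat Q (- C) (0\<^sub>m n m) P)
    = four_block_mat (mat_inv Q) (mat_inv Q * (C * mat_inv P)) (0\<^sub>m n m) (mat_inv P)"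
proof (rule mat_inv_eqI)
  note P' = mat_inv_carrier[OF P assms(4)] and Q' = mat_inv_carrier[OF Q assms(5)]
  have CP: "C * mat_inv P \<in> carrier_mat m n"
    using C P' by simp
  have "Q * (mat_inv Q * (C * mat_inv P)) = Q * mat_inv Q * (C * mat_inv P)"
    by (rule assoc_mult_mat[symmetric, OF Q Q' CP])
  also have "\<dots> = C * mat_inv P"
    by (simp only: mat_inv_right[OF Q assms(5)] left_mult_one_mat[OF CP])
  finally have "Q * (mat_inv Q * (C * mat_inv P)) + - C * mat_inv P = 0\<^sub>m m n"
    using C P' CP by (auto intro!: eq_matI)
  then show "four_block_mat Q (- C) (0\<^sub>m n m) P
      * four_block_mat (mat_inv Q) (mat_inv Q * (C * mat_inv P)) (0\<^sub>m n m) (mat_inv P)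
      = 1\<^sub>m (m + n)"
    using P Q C P' Q' CP mat_inv_right[OF P assms(4)] mat_inv_right[OF Q assms(5)]
    by (subst mult_four_block_mat[where ?nr1.0 = m and ?nr2.0 = n and ?n1.0 = m and ?n2.0 = n
          and ?nc1.0 = m and ?nc2.0 = n]) auto
qed (use assms mat_inv_carrier[OF P assms(4)] mat_inv_carrier[OF Q assms(5)] in auto)

section \<open>Extracting a corner block by a block row and a block column\<close>

lemma four_block_mat_empty:
  assumes "M \<in> carrier_mat p q"
  shows "four_block_mat M (0\<^sub>m p 0) (0\<^sub>m 0 q) (0\<^sub>m 0 0) = M"
  using assms by (intro eq_matI) auto

text \<open>Block rows and block columns are written as four-block matrices with empty blocks.\<close>

lemma block_row_mult_block_col_lower:
  fixes G1 :: "'a :: comm_ring_1 mat"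
  assumes G: "G1 \<in> carrier_mat n n" "G2 \<in> carrier_mat n m" "G3 \<in> carrier_mat m n" "G4 \<in> carrier_mat m m"
    and X: "X \<in> carrier_mat p m" and Y: "Y \<in> carrier_mat n q"
  shows "four_block_mat (0\<^sub>m p n) X (0\<^sub>m 0 n) (0\<^sub>m 0 m) * four_block_mat G1 G2 G3 G4
    * four_block_mat Y (0\<^sub>m n 0) (0\<^sub>m m q) (0\<^sub>m m 0) = X * G3 * Y"
proof -
  \<comment> \<open>The zero block of the row discards \<open>G1\<close> and \<open>G2\<close>;
    multiplying by the column then discards \<open>G4\<close>. The second block row has height 0, so
    the ordinary 2 by 2 block product applies.\<close>
  have "four_block_mat (0\<^sub>m p n) X (0\<^sub>m 0 n) (0\<^sub>m 0 m) * four_block_mat G1 G2 G3 G4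
      = four_block_mat (X * G3) (X * G4) (0\<^sub>m 0 n) (0\<^sub>m 0 m)"
    using G X by (subst mult_four_block_mat[where ?nr1.0 = p and ?nr2.0 = 0 and ?n1.0 = n
          and ?n2.0 = m and ?nc1.0 = n and ?nc2.0 = m]) auto
  also have "\<dots> * four_block_mat Y (0\<^sub>m n 0) (0\<^sub>m m q) (0\<^sub>m m 0)
      = four_block_mat (X * G3 * Y) (0\<^sub>m p 0) (0\<^sub>m 0 q) (0\<^sub>m 0 0)"
    using G X Y by (subst mult_four_block_mat[where ?nr1.0 = p and ?nr2.0 = 0 and ?n1.0 = n
          and ?n2.0 = m and ?nc1.0 = q and ?nc2.0 = 0]) auto
  also have "\<dots> = X * G3 * Y"
    using G X Y by (intro four_block_mat_empty) auto
  finally show ?thesis .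
qed

text \<open>The counterpart for the upper triangular pencil, whose inverse has its coupling block in
  the upper right corner.\<close>

lemma block_row_mult_block_col_upper:
  fixes G1 :: "'a :: comm_ring_1 mat"
  assumes G: "G1 \<in> carrier_mat n n" "G2 \<in> carrier_mat n m" "G3 \<in> carrier_mat m n" "G4 \<in> carrier_mat m m"
    and X: "X \<in> carrier_mat p n" and Y: "Y \<in> carrier_mat m q"
  shows "four_block_mat X (0\<^sub>m p m) (0\<^sub>m 0 n) (0\<^sub>m 0 m) * four_block_mat G1 G2 G3 G4
    * four_block_mat (0\<^sub>m n q) (0\<^sub>m n 0) Y (0\<^sub>m m 0) = X * G2 * Y"
proof -
  have "four_block_mat X (0\<^sub>m p m) (0\<^sub>m 0 n) (0\<^sub>m 0 m) * four_block_mat G1 G2 G3 G4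
      = four_block_mat (X * G1) (X * G2) (0\<^sub>m 0 n) (0\<^sub>m 0 m)"
    using G X by (subst mult_four_block_mat[where ?nr1.0 = p and ?nr2.0 = 0 and ?n1.0 = n
          and ?n2.0 = m and ?nc1.0 = n and ?nc2.0 = m]) auto
  also have "\<dots> * four_block_mat (0\<^sub>m n q) (0\<^sub>m n 0) Y (0\<^sub>m m 0)
      = four_block_mat (X * G2 * Y) (0\<^sub>m p 0) (0\<^sub>m 0 q) (0\<^sub>m 0 0)"
    using G X Y by (subst mult_four_block_mat[where ?nr1.0 = p and ?nr2.0 = 0 and ?n1.0 = n
          and ?n2.0 = m and ?nc1.0 = q and ?nc2.0 = 0]) auto
  also have "\<dots> = X * G2 * Y"
    using G X Y by (intro four_block_mat_empty) auto
  finally show ?thesis .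
qed

section \<open>Evaluation of matrix polynomials and block pencils\<close>

lemma mpoly_eval_carrier [simp]:
  "mpoly_eval P z \<in> carrier_mat n m \<longleftrightarrow> P \<in> carrier_mat n m"
  by (simp add: mpoly_eval_def)

lemma mpoly_eval_mult:
  assumes "P \<in> carrier_mat n m" and "Q \<in> carrier_mat m k"
  shows "mpoly_eval (P * Q) z = mpoly_eval P z * mpoly_eval Q z"
proof -
  interpret semiring_hom "\<lambda>f. poly f z"
    by unfold_locales auto
  show ?thesis
    unfolding mpoly_eval_def by (rule mat_hom_mult[OF assms])
qed

lemma pencil_carrier:
  assumes "D \<in> carrier_mat n n" and "M \<in> carrier_mat n n"
  shows "pencil D M z \<in> carrier_mat n n"
  using assms by (simp add: pencil_def minus_carrier_mat)

text \<open>The leading matrix is block diagonal, so the coupling block \<open>C\<close> enters the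
  pencil as a constant, with its sign reversed.\<close>

lemma pencil_block_lower:
  assumes "D \<in> carrier_mat n n" and "M \<in> carrier_mat n n"
    and "E \<in> carrier_mat m m" and "N \<in> carrier_mat m m" and "C \<in> carrier_mat m n"
  shows "pencil (four_block_mat D (0\<^sub>m n m) (0\<^sub>m m n) E) (four_block_mat M (0\<^sub>m n m) C N) z
    = four_block_mat (pencil D M z) (0\<^sub>m n m) (- C) (pencil E N z)"
  unfolding pencil_def using assms by (intro eq_matI) auto

lemma pencil_block_upper:
  assumes "D \<in> carrier_mat n n" and "M \<in> carrier_mat n n"
    and "E \<in> carrier_mat m m" and "N \<in> carrier_mat m m" and "C \<in> carrier_mat m n"
  shows "pencil (four_block_mat E (0\<^sub>m m n) (0\<^sub>m n m) D) (four_block_mat N C (0\<^sub>m n m) M) z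
    = four_block_mat (pencil E N z) (- C) (0\<^sub>m n m) (pencil D M z)"
  unfolding pencil_def using assms by (intro eq_matI) auto

section \<open>The two linearizations of the product\<close>

theorem theorem2:
  fixes r s t :: nat
    and a b :: "complex poly mat"
    and D\<^sub>A A X\<^sub>A Y\<^sub>A D\<^sub>B B X\<^sub>B Y\<^sub>B :: "complex mat"
  assumes "r \<ge> 1" and "s \<ge> 1" and "t \<ge> 1"
    and "a \<in> carrier_mat r r" and "b \<in> carrier_mat r r"
    and "mpoly_degree a = s" and "mpoly_degree b = t"
    and "\<exists>z. det (mpoly_eval a z) \<noteq> 0" and "\<exists>z. det (mpoly_eval b z) \<noteq> 0"
    and "D\<^sub>A \<in> carrier_mat (r * s) (r * s)" and "A \<in> carrier_mat (r * s) (r * s)"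
    and "X\<^sub>A \<in> carrier_mat r (r * s)" and "Y\<^sub>A \<in> carrier_mat (r * s) r"
    and "\<forall>z. det (mpoly_eval a z) = det (pencil D\<^sub>A A z)"
    and "\<forall>z \<in> - mpoly_spectrum a.
           mat_inv (mpoly_eval a z) = X\<^sub>A * mat_inv (pencil D\<^sub>A A z) * Y\<^sub>A"
    and "D\<^sub>B \<in> carrier_mat (r * t) (r * t)" and "B \<in> carrier_mat (r * t) (r * t)"
    and "X\<^sub>B \<in> carrier_mat r (r * t)" and "Y\<^sub>B \<in> carrier_mat (r * t) r"
    and "\<forall>z. det (mpoly_eval b z) = det (pencil D\<^sub>B B z)"
    and "\<forall>z \<in> - mpoly_spectrum b.
           mat_inv (mpoly_eval b z) = X\<^sub>B * mat_inv (pencil D\<^sub>B B z) * Y\<^sub>B"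
  shows "is_linearization r (r * s + r * t)
           (four_block_mat D\<^sub>A (0\<^sub>m (r * s) (r * t)) (0\<^sub>m (r * t) (r * s)) D\<^sub>B)
           (four_block_mat A (0\<^sub>m (r * s) (r * t)) (Y\<^sub>B * X\<^sub>A) B)
           (a * b)
       \<and> is_linearization r (r * t + r * s)
           (four_block_mat D\<^sub>B (0\<^sub>m (r * t) (r * s)) (0\<^sub>m (r * s) (r * t)) D\<^sub>A)
           (four_block_mat B (Y\<^sub>B * X\<^sub>A) (0\<^sub>m (r * s) (r * t)) A)
           (a * b)"
proof -
  let ?n = "r * s" and ?m = "r * t"
  note a = assms(4) and b = assms(5)
  note car = assms(10-13,16-19)
  define P where "P = pencil D\<^sub>A A"
  define Q where "Q = pencil D\<^sub>B B"
  define C where "C = Y\<^sub>B * X\<^sub>A"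
  have P: "P z \<in> carrier_mat ?n ?n" and Q: "Q z \<in> carrier_mat ?m ?m" for z
    using car by (auto simp: P_def Q_def intro: pencil_carrier)
  have C: "C \<in> carrier_mat ?m ?n"
    using car by (simp add: C_def)
  have detP: "det (P z) = det (mpoly_eval a z)" and detQ: "det (Q z) = det (mpoly_eval b z)" for z
    using assms(14,20) by (auto simp: P_def Q_def)
  have det_ab: "det (mpoly_eval (a * b) z) = det (P z) * det (Q z)" for z
    using a b detP detQ by (simp add: mpoly_eval_mult det_mult[where n = r])
  \<comment> \<open>Both pencils use this one identity. Since \<open>C\<close> is
    \<open>Y\<^sub>B * X\<^sub>A\<close>, reassociating cuts the chain between these factors: the
    left part is the given realization of the inverse of \<open>b\<close>, the right part that of
    \<open>a\<close>.\<close>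
  have resolvent: "X\<^sub>B * (mat_inv (Q z) * (C * mat_inv (P z))) * Y\<^sub>A = mat_inv (mpoly_eval (a * b) z)"
    if "det (P z) \<noteq> 0" "det (Q z) \<noteq> 0" for z
  proof -
    note P' = mat_inv_carrier[OF P that(1)] and Q' = mat_inv_carrier[OF Q that(2)]
    note XA = car(3) and YA = car(4) and XB = car(7) and YB = car(8)
    have XP: "X\<^sub>A * mat_inv (P z) \<in> carrier_mat r ?n"
      and QY: "mat_inv (Q z) * Y\<^sub>B \<in> carrier_mat ?m r"
      and XPY: "X\<^sub>A * mat_inv (P z) * Y\<^sub>A \<in> carrier_mat r r"
      using P' Q' XA YA YB by auto
    have "C * mat_inv (P z) = Y\<^sub>B * (X\<^sub>A * mat_inv (P z))"
      unfolding C_def by (rule assoc_mult_mat[OF YB XA P'])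
    then have "X\<^sub>B * (mat_inv (Q z) * (C * mat_inv (P z)))
        = X\<^sub>B * (mat_inv (Q z) * Y\<^sub>B * (X\<^sub>A * mat_inv (P z)))"
      by (simp add: assoc_mult_mat[OF Q' YB XP])
    also have "\<dots> = X\<^sub>B * (mat_inv (Q z) * Y\<^sub>B) * (X\<^sub>A * mat_inv (P z))"
      by (rule assoc_mult_mat[symmetric, OF XB QY XP])
    also have "X\<^sub>B * (mat_inv (Q z) * Y\<^sub>B) = X\<^sub>B * mat_inv (Q z) * Y\<^sub>B"
      by (rule assoc_mult_mat[symmetric, OF XB Q' YB])
    also have "\<dots> = mat_inv (mpoly_eval b z)"
      using assms(21) that(2) by (simp add: Q_def[symmetric] detQ mpoly_spectrum_def)
    finally have "X\<^sub>B * (mat_inv (Q z) * (C * mat_inv (P z))) * Y\<^sub>A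
        = mat_inv (mpoly_eval b z) * (X\<^sub>A * mat_inv (P z)) * Y\<^sub>A"
      by simp
    also have "\<dots> = mat_inv (mpoly_eval b z) * (X\<^sub>A * mat_inv (P z) * Y\<^sub>A)"
      using b that(2) by (intro assoc_mult_mat[OF mat_inv_carrier XP YA]) (auto simp: detQ)
    also have "X\<^sub>A * mat_inv (P z) * Y\<^sub>A = mat_inv (mpoly_eval a z)"
      using assms(15) that(1) by (simp add: P_def[symmetric] detP mpoly_spectrum_def)
    \<comment> \<open>Inversion reverses the order of the factors, which is why the realization of
      \<open>b\<close> has to stand on the left.\<close>
    also have "mat_inv (mpoly_eval b z) * mat_inv (mpoly_eval a z)
        = mat_inv (mpoly_eval (a * b) z)"
      using a b that by (simp add: mpoly_eval_mult detP detQ mat_inv_mult[where n = r])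
    finally show ?thesis .
  qed
  \<comment> \<open>By \<open>det_ab\<close>, a point outside the spectrum of the product lies
    outside both spectra, so both given realizations are available there.\<close>
  have nonsing: "det (P z) \<noteq> 0" "det (Q z) \<noteq> 0" if "z \<notin> mpoly_spectrum (a * b)" for z
    using that by (auto simp: mpoly_spectrum_def det_ab)
  have pencil1: "pencil (four_block_mat D\<^sub>A (0\<^sub>m ?n ?m) (0\<^sub>m ?m ?n) D\<^sub>B)
      (four_block_mat A (0\<^sub>m ?n ?m) C B) z = four_block_mat (P z) (0\<^sub>m ?n ?m) (- C) (Q z)" for z
    unfolding P_def Q_def using car C by (intro pencil_block_lower)
  have pencil2: "pencil (four_block_mat D\<^sub>B (0\<^sub>m ?m ?n) (0\<^sub>m ?n ?m) D\<^sub>A)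
      (four_block_mat B C (0\<^sub>m ?n ?m) A) z = four_block_mat (Q z) (- C) (0\<^sub>m ?n ?m) (P z)" for z
    unfolding P_def Q_def using car C by (intro pencil_block_upper)
  have "is_linearization r (?n + ?m)
      (four_block_mat D\<^sub>A (0\<^sub>m ?n ?m) (0\<^sub>m ?m ?n) D\<^sub>B) (four_block_mat A (0\<^sub>m ?n ?m) C B) (a * b)"
    unfolding is_linearization_def pencil1
  proof (intro conjI allI bexI impI)
    \<comment> \<open>A block triangular determinant is the product of the diagonal ones,
      independently of \<open>C\<close>.\<close>
    show "det (four_block_mat (P z) (0\<^sub>m ?n ?m) (- C) (Q z)) = det (mpoly_eval (a * b) z)" for z
      using C det_four_block_mat_upper_right_zero[OF P refl _ Q] by (simp add: det_ab)
    show "four_block_mat (0\<^sub>m r ?n) X\<^sub>B (0\<^sub>m 0 ?n) (0\<^sub>m 0 ?m) \<in> carrier_mat r (?n + ?m)"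
      "four_block_mat Y\<^sub>A (0\<^sub>m ?n 0) (0\<^sub>m ?m r) (0\<^sub>m ?m 0) \<in> carrier_mat (?n + ?m) r"
      using car by auto
    fix z assume "z \<notin> mpoly_spectrum (a * b)"
    note ns = nonsing[OF this]
    note P' = mat_inv_carrier[OF P ns(1)] and Q' = mat_inv_carrier[OF Q ns(2)]
    show "four_block_mat (0\<^sub>m r ?n) X\<^sub>B (0\<^sub>m 0 ?n) (0\<^sub>m 0 ?m)
        * mat_inv (four_block_mat (P z) (0\<^sub>m ?n ?m) (- C) (Q z))
        * four_block_mat Y\<^sub>A (0\<^sub>m ?n 0) (0\<^sub>m ?m r) (0\<^sub>m ?m 0) = mat_inv (mpoly_eval (a * b) z)"
      \<comment> \<open>Rewriting the right-hand side backwards with \<open>resolvent\<close> turns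
        the goal into the extraction of the lower left block.\<close>
      unfolding mat_inv_block_lower[OF P Q C ns] resolvent[OF ns, symmetric]
      using P' Q' C car by (intro block_row_mult_block_col_lower) auto
  qed (use a b car C in auto)
  moreover have "is_linearization r (?m + ?n)
      (four_block_mat D\<^sub>B (0\<^sub>m ?m ?n) (0\<^sub>m ?n ?m) D\<^sub>A) (four_block_mat B C (0\<^sub>m ?n ?m) A) (a * b)"
    unfolding is_linearization_def pencil2
  proof (intro conjI allI bexI impI)
    show "det (four_block_mat (Q z) (- C) (0\<^sub>m ?n ?m) (P z)) = det (mpoly_eval (a * b) z)" for z
      using C det_four_block_mat_lower_left_zero[OF Q _ refl P] by (simp add: det_ab)
    \<comment> \<open>The diagonal blocks have changed places, so the witnesses are now the row
      \<open>[X\<^sub>B 0]\<close> and the column \<open>[0; Y\<^sub>A]\<close>, which pick out the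
      upper right corner.\<close>
    show "four_block_mat X\<^sub>B (0\<^sub>m r ?n) (0\<^sub>m 0 ?m) (0\<^sub>m 0 ?n) \<in> carrier_mat r (?m + ?n)"
      "four_block_mat (0\<^sub>m ?m r) (0\<^sub>m ?m 0) Y\<^sub>A (0\<^sub>m ?n 0) \<in> carrier_mat (?m + ?n) r"
      using car by auto
    fix z assume "z \<notin> mpoly_spectrum (a * b)"
    note ns = nonsing[OF this]
    note P' = mat_inv_carrier[OF P ns(1)] and Q' = mat_inv_carrier[OF Q ns(2)]
    show "four_block_mat X\<^sub>B (0\<^sub>m r ?n) (0\<^sub>m 0 ?m) (0\<^sub>m 0 ?n)
        * mat_inv (four_block_mat (Q z) (- C) (0\<^sub>m ?n ?m) (P z))
        * four_block_mat (0\<^sub>m ?m r) (0\<^sub>m ?m 0) Y\<^sub>A (0\<^sub>m ?n 0) = mat_inv (mpoly_eval (a * b) z)"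
      unfolding mat_inv_block_upper[OF P Q C ns] resolvent[OF ns, symmetric]
      using P' Q' C car by (intro block_row_mult_block_col_upper) auto
  qed (use a b car C in auto)
  ultimately show ?thesis
    unfolding C_def by blast
qed

end
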